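(* Given a temporal cost graph $(G,F)$ with $n$ vertices and lifetime $T$, \textsc{Colourful Changing Cost Temporal Orienteering} can be solved on any instance $((G,F),v_s,v_t,k,c,f)$ in $O(k!\,n^4T^4)$ time.
   Context: A temporal cost graph is a pair $(G,F)$ where $G=(V,E)$ is a static graph and $F:V\times V\times[T]\times[T]\to\mathbb{N}_0\cup\{\infty\}$ ($F(v_1,v_2,t_1,t_2)$ is the cost of departing $v_1$ at time $t_1$ and arriving at $v_2$ at time $t_2$), with $F(v_1,v_2,t_1,t_2)=\infty$ whenever $t_1\ge t_2$, $F(v,v,t_1,t_2)=0$ for all $v$ and $t_1<t_2$, and $F(v_1,v_2,t_1,t_2)>0$ whenever $v_1\ne v_2$; values of $F$ can be looked up in constant time. The lifetime $T$ is the latest time $t'$ such that $F(v,u,t,t')<\infty$ for some $v,u,t$. A valid walk is a sequence $(u_1,v_1,t_1,t_1'),\dots,(u_\ell,v_\ell,t_\ell,t_\ell')$ with $v_i=u_{i+1}$ and $t_i'\le t_{i+1}$ for consecutive entries, and $t_i<t_i'$, $F(u_i,v_i,t_i,t_i')<\infty$ for all $i$; its cost is $\sum_iF(u_i,v_i,t_i,t_i')$. \textsc{Colourful Changing Cost Temporal Orienteering}: given a temporal cost graph $(G=(V,E),F)$, a source vertex $v_s$, a sink vertex $v_t$, $k\in\mathbb{N}$, a colouring $c:V\setminus\{v_s,v_t\}\to[k-2]$ and a budget $f\in\mathbb{N}$, decide whether there is a valid walk from $v_s$ to $v_t$ that visits at least one vertex of each colour in $[k-2]$ and has cost at most $f$.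 *)

theory Defs
  imports Complex_Main "HOL-Library.Extended_Nat"
begin

text \<open>The set of times \<open>[T]\<close> is \<open>{1..horizon G}\<close>. Only the values of \<open>cost G\<close> on
  \<open>V \<times> V \<times> [T] \<times> [T]\<close> are meaningful; nothing is assumed about it elsewhere.
  The static edge set plays no role in the notion of a valid walk, so it may be any relation on
  the vertices (an undirected graph is a symmetric one).\<close>

record 'v cost_graph =
  verts   :: "'v set"
  edges   :: "('v \<times> 'v) set"
  horizon :: nat
  cost    :: "'v \<Rightarrow> 'v \<Rightarrow> nat \<Rightarrow> nat \<Rightarrow> enat"

definition times :: "'v cost_graph \<Rightarrow> nat set" where
  "times G = {1..horizon G}"

definition temporal_cost_graph :: "'v cost_graph \<Rightarrow> bool" where
  "temporal_cost_graph G \<longleftrightarrow>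
     finite (verts G) \<and> edges G \<subseteq> verts G \<times> verts G \<and>
     (\<forall>u\<in>verts G. \<forall>v\<in>verts G. \<forall>t\<in>times G. \<forall>t'\<in>times G.
        (t \<ge> t' \<longrightarrow> cost G u v t t' = \<infinity>) \<and>
        (u = v \<and> t < t' \<longrightarrow> cost G u v t t' = 0) \<and>
        (u \<noteq> v \<longrightarrow> cost G u v t t' > 0))"

text \<open>If no cost is finite, there is no latest arrival time; the lifetime is then taken to be 1.\<close>

definition lifetime :: "'v cost_graph \<Rightarrow> nat" where
  "lifetime G = Max (insert 1 {t' \<in> times G.
     \<exists>u\<in>verts G. \<exists>v\<in>verts G. \<exists>t\<in>times G. cost G u v t t' < \<infinity>})"

text \<open>Since waiting at a vertex is free, the lifetime agrees with the \<open>T\<close> bounding the domain of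
  the cost function.\<close>

lemma lifetime_eq_horizon:
  assumes G: "temporal_cost_graph G" and ne: "verts G \<noteq> {}" and T: "horizon G \<ge> 1"
  shows "lifetime G = horizon G"
proof -
  let ?A = "{t' \<in> times G. \<exists>u\<in>verts G. \<exists>v\<in>verts G. \<exists>t\<in>times G. cost G u v t t' < \<infinity>}"
  have sub: "insert 1 ?A \<subseteq> {1..horizon G}"
    using T by (auto simp: times_def)
  have "horizon G \<in> insert 1 ?A"
  proof (cases "horizon G = 1")
    case False
    obtain v where v: "v \<in> verts G" using ne by blast
    have "1 \<in> times G" "horizon G \<in> times G" "1 < horizon G"
      using T False by (auto simp: times_def)
    moreover from this v G have "cost G v v 1 (horizon G) = 0"
      by (simp add: temporal_cost_graph_def)
    then have "cost G v v 1 (horizon G) < \<infinity>" by simp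
    ultimately have "horizon G \<in> ?A" using v by blast
    then show ?thesis by (rule insertI2)
  qed simp
  moreover have "finite (insert 1 ?A)" by (rule finite_subset[OF sub]) simp
  ultimately show ?thesis
    unfolding lifetime_def using T by (intro Max_eqI) (auto simp: times_def)
qed

text \<open>A step \<open>(u, v, t, t')\<close> departs \<open>u\<close> at time \<open>t\<close> and arrives at \<open>v\<close> at time \<open>t'\<close>.\<close>

type_synonym 'v step = "'v \<times> 'v \<times> nat \<times> nat"

definition valid_walk :: "'v cost_graph \<Rightarrow> 'v step list \<Rightarrow> bool" where
  "valid_walk G w \<longleftrightarrow>
     (\<forall>(u, v, t, t') \<in> set w.
        u \<in> verts G \<and> v \<in> verts G \<and> t \<in> times G \<and> t' \<in> times G \<and>
        t < t' \<and> cost G u v t t' < \<infinity>) \<and>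
     successively (\<lambda>(_, v, _, t') (u, _, t, _). v = u \<and> t' \<le> t) w"

definition walk_cost :: "'v cost_graph \<Rightarrow> 'v step list \<Rightarrow> enat" where
  "walk_cost G w = (\<Sum>(u, v, t, t') \<leftarrow> w. cost G u v t t')"

definition walk_from_to :: "'v \<Rightarrow> 'v \<Rightarrow> 'v step list \<Rightarrow> bool" where
  "walk_from_to x y w \<longleftrightarrow> w \<noteq> [] \<and> fst (hd w) = x \<and> fst (snd (last w)) = y"

definition visited :: "'v step list \<Rightarrow> 'v set" where
  "visited w = (\<Union>(u, v, t, t') \<in> set w. {u, v})"

text \<open>The function \<open>colouring\<close> is only meaningful on the vertices other than source and sink.
  For \<open>k < 2\<close> the set of colours \<open>[k-2] = {1..k-2}\<close> is empty, in agreement with truncated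
  subtraction.\<close>

record 'v ccto_instance =
  graph      :: "'v cost_graph"
  source     :: 'v
  sink       :: 'v
  num_k      :: nat
  colouring  :: "'v \<Rightarrow> nat"
  budget     :: nat

definition colours :: "'v ccto_instance \<Rightarrow> nat set" where
  "colours I = {1..num_k I - 2}"

definition ccto_wf :: "'v ccto_instance \<Rightarrow> bool" where
  "ccto_wf I \<longleftrightarrow> temporal_cost_graph (graph I) \<and>
     source I \<in> verts (graph I) \<and> sink I \<in> verts (graph I) \<and>
     (\<forall>v \<in> verts (graph I) - {source I, sink I}. colouring I v \<in> colours I)"

definition ccto_yes :: "'v ccto_instance \<Rightarrow> bool" where
  "ccto_yes I \<longleftrightarrow> (\<exists>w. valid_walk (graph I) w \<and> walk_from_to (source I) (sink I) w \<and>
     (\<forall>q \<in> colours I. \<exists>v \<in> visited w - {source I, sink I}. colouring I v = q) \<and>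
     walk_cost (graph I) w \<le> enat (budget I))"

text \<open>A unit-cost random access machine over the natural numbers, presented as a structured
  language with registers and unbounded arrays. A program mentions only finitely many of them;
  all are initially zero except for the input registers. Apart from reads and writes of the
  memory, the only operations are addition, truncated subtraction and comparison (there is no
  multiplication), and constant-time lookups of the edges, costs and colours of the input.\<close>

record lookup_input =
  in_edge   :: "nat \<Rightarrow> nat \<Rightarrow> nat"
  in_cost   :: "nat \<Rightarrow> nat \<Rightarrow> nat \<Rightarrow> nat \<Rightarrow> nat"
  in_colour :: "nat \<Rightarrow> nat"

record store =
  reg :: "string \<Rightarrow> nat"
  arr :: "string \<Rightarrow> nat \<Rightarrow> nat"

datatype aexp =
    Const nat
  | Reg string
  | Arr string aexp
  | Add aexp aexp
  | Sub aexp aexp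
  | EdgeAt aexp aexp
  | CostAt aexp aexp aexp aexp
  | ColourAt aexp

datatype bexp = Less aexp aexp | Not bexp | And bexp bexp

datatype com =
    Skip
  | Assign string aexp
  | Write string aexp aexp
  | Seq com com
  | If bexp com com
  | While bexp com

fun aval :: "lookup_input \<Rightarrow> store \<Rightarrow> aexp \<Rightarrow> nat" where
  "aval X s (Const m) = m"
| "aval X s (Reg x) = reg s x"
| "aval X s (Arr x a) = arr s x (aval X s a)"
| "aval X s (Add a b) = aval X s a + aval X s b"
| "aval X s (Sub a b) = aval X s a - aval X s b"
| "aval X s (EdgeAt a b) = in_edge X (aval X s a) (aval X s b)"
| "aval X s (CostAt a b t t') = in_cost X (aval X s a) (aval X s b) (aval X s t) (aval X s t')"
| "aval X s (ColourAt a) = in_colour X (aval X s a)"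

fun bval :: "lookup_input \<Rightarrow> store \<Rightarrow> bexp \<Rightarrow> bool" where
  "bval X s (Less a b) \<longleftrightarrow> aval X s a < aval X s b"
| "bval X s (Not p) \<longleftrightarrow> \<not> bval X s p"
| "bval X s (And p q) \<longleftrightarrow> bval X s p \<and> bval X s q"

text \<open>Evaluating an expression takes one time unit for each of its nodes.\<close>

fun atime :: "aexp \<Rightarrow> nat" where
  "atime (Const m) = 1"
| "atime (Reg x) = 1"
| "atime (Arr x a) = 1 + atime a"
| "atime (Add a b) = 1 + atime a + atime b"
| "atime (Sub a b) = 1 + atime a + atime b"
| "atime (EdgeAt a b) = 1 + atime a + atime b"
| "atime (CostAt a b t t') = 1 + atime a + atime b + atime t + atime t'"
| "atime (ColourAt a) = 1 + atime a"

fun btime :: "bexp \<Rightarrow> nat" where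
  "btime (Less a b) = 1 + atime a + atime b"
| "btime (Not p) = 1 + btime p"
| "btime (And p q) = 1 + btime p + btime q"

text \<open>\<open>exec X c s m s'\<close>: on input \<open>X\<close>, the program \<open>c\<close> started in the store \<open>s\<close> halts in the
  store \<open>s'\<close> after exactly \<open>m\<close> time units.\<close>

inductive exec :: "lookup_input \<Rightarrow> com \<Rightarrow> store \<Rightarrow> nat \<Rightarrow> store \<Rightarrow> bool" for X where
  exec_Skip: "exec X Skip s 1 s"
| exec_Assign: "exec X (Assign x a) s (1 + atime a) (s\<lparr>reg := (reg s)(x := aval X s a)\<rparr>)"
| exec_Write: "exec X (Write x a b) s (1 + atime a + atime b)
    (s\<lparr>arr := (arr s)(x := (arr s x)(aval X s a := aval X s b))\<rparr>)"
| exec_Seq: "exec X c s m s' \<Longrightarrow> exec X d s' m' s'' \<Longrightarrow> exec X (Seq c d) s (m + m') s''"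
| exec_If_True: "bval X s p \<Longrightarrow> exec X c s m s' \<Longrightarrow> exec X (If p c d) s (1 + btime p + m) s'"
| exec_If_False: "\<not> bval X s p \<Longrightarrow> exec X d s m s' \<Longrightarrow> exec X (If p c d) s (1 + btime p + m) s'"
| exec_While_False: "\<not> bval X s p \<Longrightarrow> exec X (While p c) s (1 + btime p) s"
| exec_While_True: "bval X s p \<Longrightarrow> exec X c s m s' \<Longrightarrow> exec X (While p c) s' m' s'' \<Longrightarrow>
    exec X (While p c) s (1 + btime p + m + m') s''"

inductive_cases exec_SkipE: "exec X Skip s m s'"
inductive_cases exec_AssignE: "exec X (Assign x a) s m s'"
inductive_cases exec_WriteE: "exec X (Write x a b) s m s'"
inductive_cases exec_SeqE: "exec X (Seq c d) s m s'"
inductive_cases exec_IfE: "exec X (If p c d) s m s'"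
inductive_cases exec_WhileE: "exec X (While p c) s m s'"

lemma exec_deterministic:
  "exec X c s m s' \<Longrightarrow> exec X c s m' s'' \<Longrightarrow> m' = m \<and> s'' = s'"
proof (induction arbitrary: m' s'' rule: exec.induct)
  case exec_Skip
  then show ?case by (auto elim: exec_SkipE)
next
  case exec_Assign
  then show ?case by (auto elim: exec_AssignE)
next
  case exec_Write
  then show ?case by (auto elim: exec_WriteE)
next
  case exec_Seq
  from exec_Seq.prems show ?case by (rule exec_SeqE) (metis exec_Seq.IH)
next
  case exec_If_True
  from exec_If_True.prems show ?case
    by (rule exec_IfE) (auto dest!: exec_If_True.IH simp: exec_If_True.hyps)
next
  case exec_If_False
  from exec_If_False.prems show ?case
    by (rule exec_IfE) (auto dest!: exec_If_False.IH simp: exec_If_False.hyps)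
next
  case exec_While_False
  from exec_While_False.prems show ?case
    by (rule exec_WhileE) (simp_all add: exec_While_False.hyps)
next
  case exec_While_True
  from exec_While_True.prems show ?case
    by (rule exec_WhileE) (use exec_While_True.hyps in \<open>auto dest!: exec_While_True.IH\<close>)
qed

text \<open>The machine addresses the vertices by numbers below \<open>n\<close>, via an arbitrary numbering.\<close>

definition numbering :: "(nat \<Rightarrow> 'v) \<Rightarrow> 'v set \<Rightarrow> bool" where
  "numbering e V \<longleftrightarrow> bij_betw e {..<card V} V"

text \<open>Registers hold natural numbers only: an infinite cost is presented as \<open>0\<close> and a finite
  cost \<open>m\<close> as \<open>m + 1\<close>.\<close>

definition encode_cost :: "enat \<Rightarrow> nat" where
  "encode_cost x = (case x of enat m \<Rightarrow> Suc m | \<infinity> \<Rightarrow> 0)"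

definition ccto_lookup :: "'v ccto_instance \<Rightarrow> (nat \<Rightarrow> 'v) \<Rightarrow> lookup_input" where
  "ccto_lookup I e = \<lparr>
     in_edge = (\<lambda>i j. if (e i, e j) \<in> edges (graph I) then 1 else 0),
     in_cost = (\<lambda>i j t t'. encode_cost (cost (graph I) (e i) (e j) t t')),
     in_colour = (\<lambda>i. colouring I (e i))\<rparr>"

definition ccto_init :: "'v ccto_instance \<Rightarrow> (nat \<Rightarrow> 'v) \<Rightarrow> store" where
  "ccto_init I e = (let V = verts (graph I); index = inv_into {..<card V} e in
     \<lparr>reg = (\<lambda>_. 0)
        (''n'' := card V,
         ''T'' := horizon (graph I),
         ''source'' := index (source I),
         ''sink'' := index (sink I),
         ''k'' := num_k I,
         ''f'' := budget I),
      arr = (\<lambda>_ _. 0)\<rparr>)"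

definition decides_ccto_in ::
  "com \<Rightarrow> 'v ccto_instance \<Rightarrow> (nat \<Rightarrow> 'v) \<Rightarrow> nat \<Rightarrow> bool" where
  "decides_ccto_in prog I e b \<longleftrightarrow>
     (\<exists>m s. exec (ccto_lookup I e) prog (ccto_init I e) m s \<and> m \<le> b \<and>
        reg s ''out'' = (if ccto_yes I then 1 else 0))"

end

theory Submission
  imports Defs
begin

text \<open>Dynamic programming over states consisting of a time, the set of colours seen so far and a
  vertex. Because waiting is a free step, it suffices to consider walks that depart
  at time 1, arrive at time \<open>T\<close> and have no gap between consecutive steps. Steps increase the time, so states
  numbered with the time as most significant digit form an acyclic graph, on which one pass in
  numerical order computes all least costs. With \<open>N = n T 2 ^ (k - 2)\<close> states, considering all pairs
  and decoding their numbers by repeated subtraction takes \<open>O(N ^ 3)\<close> time; this suffices since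
  \<open>8 ^ k = O(k!)\<close>.\<close>

section \<open>A calculus for total correctness and running time\<close>

text \<open>Since \<open>exec\<close> is deterministic, one halting run that satisfies
  \<open>Q\<close> amounts to total correctness. \<open>Q\<close> also receives the running
  time.\<close>

definition wp :: "lookup_input \<Rightarrow> com \<Rightarrow> store \<Rightarrow> (nat \<Rightarrow> store \<Rightarrow> bool) \<Rightarrow> bool" where
  "wp X c s Q \<longleftrightarrow> (\<exists>m s'. exec X c s m s' \<and> Q m s')"

lemma wp_Skip [simp]: "wp X Skip s Q \<longleftrightarrow> Q 1 s"
  unfolding wp_def by (metis exec_SkipE exec_Skip)

lemma wp_Assign [simp]:
  "wp X (Assign x a) s Q \<longleftrightarrow> Q (1 + atime a) (s\<lparr>reg := (reg s)(x := aval X s a)\<rparr>)"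
  unfolding wp_def by (metis exec_AssignE exec_Assign)

lemma wp_Write [simp]:
  "wp X (Write x a b) s Q \<longleftrightarrow>
    Q (1 + atime a + atime b) (s\<lparr>arr := (arr s)(x := (arr s x)(aval X s a := aval X s b))\<rparr>)"
  unfolding wp_def by (metis exec_WriteE exec_Write)

lemma wp_Seq [simp]:
  "wp X (Seq c d) s Q \<longleftrightarrow> wp X c s (\<lambda>m s'. wp X d s' (\<lambda>m' s''. Q (m + m') s''))"
  unfolding wp_def by (blast elim: exec_SeqE intro: exec_Seq)

lemma exec_If_iff:
  "exec X (If p c d) s m s' \<longleftrightarrow>
    (\<exists>m'. m = 1 + btime p + m' \<and> exec X (if bval X s p then c else d) s m' s')"
  by (subst exec.simps) auto

lemma wp_If [simp]:
  "wp X (If p c d) s Q \<longleftrightarrow>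
    (if bval X s p then wp X c s (\<lambda>m s'. Q (1 + btime p + m) s')
     else wp X d s (\<lambda>m s'. Q (1 + btime p + m) s'))"
  unfolding wp_def exec_If_iff by auto

lemma exec_While_iff:
  "exec X (While p c) s m s'' \<longleftrightarrow>
    (if bval X s p
     then \<exists>m1 s' m2. m = 1 + btime p + m1 + m2 \<and> exec X c s m1 s' \<and> exec X (While p c) s' m2 s''
     else m = 1 + btime p \<and> s'' = s)"
  by (subst exec.simps) auto

text \<open>Not a simp rule, since repeated unfolding need not terminate; each use unrolls a single
  test.\<close>

lemma wp_While:
  "wp X (While p c) s Q \<longleftrightarrow>
    (if bval X s p
     then wp X c s (\<lambda>m s'. wp X (While p c) s' (\<lambda>m' s''. Q (1 + btime p + m + m') s''))
     else Q (1 + btime p) s)"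
  unfolding wp_def by (subst exec_While_iff) (auto; blast)

lemma wp_mono: "wp X c s Q \<Longrightarrow> (\<And>m s'. Q m s' \<Longrightarrow> Q' m s') \<Longrightarrow> wp X c s Q'"
  unfolding wp_def by blast

section \<open>Counting loops, division by subtraction, powers and products\<close>

definition For :: "string \<Rightarrow> string \<Rightarrow> com \<Rightarrow> com" where
  "For i l body = Seq (Assign i (Const 0))
     (While (Less (Reg i) (Reg l)) (Seq body (Assign i (Add (Reg i) (Const 1)))))"

text \<open>A test costs 4, the increment 4 and the initial assignment 2, so \<open>L\<close> rounds
  and the last test take at most \<open>6 + L * (b + 8)\<close>. The body has to establish
  \<open>Inv\<close> only for the store after the increment.\<close>

lemma wp_For:
  assumes init: "Inv 0 (s\<lparr>reg := (reg s)(i := 0)\<rparr>)"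
    and ctrl: "\<And>j s. Inv j s \<Longrightarrow> reg s i = j \<and> reg s l = L"
    and body: "\<And>j s. j < L \<Longrightarrow> Inv j s \<Longrightarrow>
      wp X body s (\<lambda>m s'. m \<le> b \<and> reg s' i = j \<and> Inv (Suc j) (s'\<lparr>reg := (reg s')(i := Suc j)\<rparr>))"
    and post: "\<And>m s'. m \<le> 6 + L * (b + 8) \<Longrightarrow> Inv L s' \<Longrightarrow> Q m s'"
  shows "wp X (For i l body) s Q"
proof -
  let ?w = "While (Less (Reg i) (Reg l)) (Seq body (Assign i (Add (Reg i) (Const 1))))"
  have loop: "wp X ?w s (\<lambda>m s'. m \<le> 4 + r * (b + 8) \<and> Inv L s')"
    if "Inv j s" "j + r = L" for j r s
    using that
  proof (induction r arbitrary: j s)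
    case 0
    with ctrl[OF 0(1)] show ?case by (subst wp_While) simp
  next
    case (Suc r)
    then have "j < L" by simp
    show ?case
      apply (subst wp_While)
      using ctrl[OF Suc(2)] \<open>j < L\<close> apply (simp del: One_nat_def)
      apply (rule wp_mono[OF body[OF \<open>j < L\<close> Suc(2)]])
      apply (clarsimp simp del: One_nat_def)
      apply (rule wp_mono[OF Suc.IH[of "Suc j"]])
      using Suc.prems by auto
  qed
  show ?thesis
    unfolding For_def
    by (simp del: One_nat_def, rule wp_mono[OF loop[OF init, of L]]) (auto intro: post)
qed

definition Divmod :: "string \<Rightarrow> string \<Rightarrow> string \<Rightarrow> string \<Rightarrow> com" where
  "Divmod a b q r = Seq (Assign q (Const 0)) (Seq (Assign r (Reg a))
     (While (Not (Less (Reg r) (Reg b)))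
       (Seq (Assign r (Sub (Reg r) (Reg b))) (Assign q (Add (Reg q) (Const 1))))))"

text \<open>Each round costs 13 and lowers the remainder by at least 1, as the divisor is positive;
  the last test costs 5 and the initial assignments 4.\<close>

lemma wp_Divmod:
  assumes b: "reg s b > 0" and d: "distinct [q, r, b]" "a \<noteq> q"
    and post: "\<And>m. m \<le> 20 * Suc (reg s a) \<Longrightarrow>
      Q m (s\<lparr>reg := (reg s)(q := reg s a div reg s b, r := reg s a mod reg s b)\<rparr>)"
  shows "wp X (Divmod a b q r) s Q"
proof -
  let ?w = "While (Not (Less (Reg r) (Reg b)))
       (Seq (Assign r (Sub (Reg r) (Reg b))) (Assign q (Add (Reg q) (Const 1))))"
  define B where "B = reg s b"
  \<comment> \<open>\<open>A\<close> generalises the current remainder and \<open>Z\<close> the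
    quotient counted so far.\<close>
  have loop: "wp X ?w s (\<lambda>m s'. m \<le> 5 + 13 * A \<and>
      s' = s\<lparr>reg := (reg s)(q := Z + A div B, r := A mod B)\<rparr>)"
    if "reg s r = A" "reg s q = Z" "reg s b = B" for A Z s
    using that
  proof (induction A arbitrary: s Z rule: less_induct)
    case (less A)
    show ?case
    proof (cases "A < B")
      case True
      with less.prems show ?thesis by (subst wp_While) (auto simp: fun_upd_idem)
    next
      case False
      have B: "B > 0" using b B_def by simp
      have eq: "A div B = Suc ((A - B) div B)" "A mod B = (A - B) mod B"
        using False B by (simp_all add: le_div_geq le_mod_geq)
      show ?thesis
        apply (subst wp_While)
        using False less.prems d apply (simp del: One_nat_def)
        apply (rule wp_mono[OF less.IH[where y = "A - B" and Z = "Suc Z"]])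
        using False B d eq less.prems by (auto intro!: store.equality simp: fun_eq_iff)
    qed
  qed
  show ?thesis
    unfolding Divmod_def
    apply (simp add: d(2) del: One_nat_def)
    apply (rule wp_mono[OF loop[where A = "reg s a" and Z = 0]])
    using d post by (auto simp: B_def fun_upd_twist)
qed

text \<open>Bit \<open>q\<close> is the leading bit of \<open>S mod 2 ^ Suc q\<close>, hence unset
  exactly if this remainder is below \<open>2 ^ q\<close>. The modulus is written as a sum because
  the program obtains it by doubling.\<close>

lemma set_bit_by_mod:
  fixes S :: nat
  shows "set_bit q S = (if S mod (2 ^ q + 2 ^ q) < 2 ^ q then S + 2 ^ q else S)"
proof -
  have "S mod (2 ^ q + 2 ^ q) = take_bit (Suc q) S"
    by (simp add: take_bit_eq_mod mult_2)
  also have "\<dots> = 2 ^ q * of_bool (bit S q) + take_bit q S"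
    by (rule take_bit_Suc_from_most)
  finally have "S mod (2 ^ q + 2 ^ q) < 2 ^ q \<longleftrightarrow> \<not> bit S q"
    using take_bit_nat_less_exp[of q S] by (auto simp del: take_bit_nat_less_exp)
  then show ?thesis by (simp add: set_bit_eq)
qed

lemma wp_doubling:
  assumes "reg s P = 1" "i \<noteq> l" "i \<noteq> P" "l \<noteq> P"
    and post: "\<And>m. m \<le> 6 + reg s l * 12 \<Longrightarrow>
      Q m (s\<lparr>reg := (reg s)(P := 2 ^ reg s l, i := reg s l)\<rparr>)"
  shows "wp X (For i l (Assign P (Add (Reg P) (Reg P)))) s Q"
  apply (rule wp_For[where L = "reg s l" and b = 4 and
        Inv = "\<lambda>j s'. s' = s\<lparr>reg := (reg s)(P := 2 ^ j, i := j)\<rparr>"])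
  using assms by (auto intro!: store.equality simp: fun_eq_iff)

lemma wp_summing:
  assumes "reg s P = 0" "i \<noteq> l" "i \<noteq> P" "l \<noteq> P" "a \<noteq> i" "a \<noteq> P"
    and post: "\<And>m. m \<le> 6 + reg s l * 12 \<Longrightarrow>
      Q m (s\<lparr>reg := (reg s)(P := reg s l * reg s a, i := reg s l)\<rparr>)"
  shows "wp X (For i l (Assign P (Add (Reg P) (Reg a)))) s Q"
  apply (rule wp_For[where L = "reg s l" and b = 4 and
        Inv = "\<lambda>j s'. s' = s\<lparr>reg := (reg s)(P := j * reg s a, i := j)\<rparr>"])
  using assms by (auto intro!: store.equality simp: fun_eq_iff)

section \<open>The dynamic program as machine code\<close>

text \<open>A state is numbered \<open>(t * 2 ^ (k - 2) + S) * n + u\<close>: the walk has arrived at vertex \<open>u\<close> at time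
  \<open>t + 1\<close>, and bit \<open>q\<close> of \<open>S\<close> is set if colour \<open>q + 1\<close> has been seen. The array \<open>D\<close> holds one plus the
  least cost of each state, or 0 if it is unreachable.\<close>

definition add_colour :: com where
  "add_colour = If
     (And (Not (And (Not (Less (Reg ''v'') (Reg ''source''))) (Not (Less (Reg ''source'') (Reg ''v'')))))
       (Not (And (Not (Less (Reg ''v'') (Reg ''sink''))) (Not (Less (Reg ''sink'') (Reg ''v''))))))
     (Seq (Assign ''q'' (Sub (ColourAt (Reg ''v'')) (Const 1)))
     (Seq (Assign ''P'' (Const 1))
     (Seq (For ''i'' ''q'' (Assign ''P'' (Add (Reg ''P'') (Reg ''P''))))
     (Seq (Assign ''PP'' (Add (Reg ''P'') (Reg ''P'')))
     (Seq (Divmod ''S'' ''PP'' ''d'' ''r'')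
     (If (Less (Reg ''r'') (Reg ''P'')) (Assign ''S'' (Add (Reg ''S'') (Reg ''P''))) Skip))))))
     Skip"

definition decode :: com where
  "decode =
     Seq (Divmod ''x'' ''W'' ''t'' ''r'')
     (Seq (Divmod ''r'' ''n'' ''S'' ''u'')
     (Seq (Divmod ''y'' ''W'' ''t2'' ''r'')
     (Divmod ''r'' ''n'' ''S2'' ''v'')))"

definition compute_weight :: com where
  "compute_weight = Seq decode (Seq add_colour
     (If (And (Not (Less (Reg ''S'') (Reg ''S2''))) (Not (Less (Reg ''S2'') (Reg ''S''))))
       (Assign ''w'' (CostAt (Reg ''u'') (Reg ''v'')
         (Add (Reg ''t'') (Const 1)) (Add (Reg ''t2'') (Const 1))))
       (Assign ''w'' (Const 0))))"

text \<open>Table entries and weights are costs plus one, so the candidate is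
  \<open>Dx + w - 1\<close>, and a positive \<open>Dy\<close> is at least as good exactly if
  \<open>Dy < Dx + w\<close>.\<close>

definition relax :: com where
  "relax = (let Dx = Arr ''D'' (Reg ''x''); Dy = Arr ''D'' (Reg ''y'') in
     If (And (And (Less (Const 0) Dx) (Less (Const 0) (Reg ''w'')))
          (Not (And (Less (Const 0) Dy) (Less Dy (Add Dx (Reg ''w''))))))
       (Write ''D'' (Reg ''y'') (Sub (Add Dx (Reg ''w'')) (Const 1))) Skip)"

text \<open>All entries below \<open>y\<close> are final when \<open>y\<close> is processed, and
  \<open>y\<close> collects from them alone.\<close>

definition main_loop :: com where
  "main_loop = For ''y'' ''N'' (For ''x'' ''y'' (Seq compute_weight relax))"

text \<open>\<open>W\<close> and \<open>N\<close> accumulate from their initial value 0. The start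
  state has time digit 0 and no colours, so its number is the index of the source; entry 1 means
  cost 0.\<close>

definition setup_program :: com where
  "setup_program =
     Seq (Assign ''m'' (Sub (Reg ''k'') (Const 2)))
     (Seq (Assign ''M'' (Const 1))
     (Seq (For ''i'' ''m'' (Assign ''M'' (Add (Reg ''M'') (Reg ''M''))))
     (Seq (For ''i'' ''M'' (Assign ''W'' (Add (Reg ''W'') (Reg ''n''))))
     (Seq (For ''i'' ''T'' (Assign ''N'' (Add (Reg ''N'') (Reg ''W''))))
     (Write ''D'' (Reg ''source'') (Const 1))))))"

text \<open>The target has the last time and all colours, so it lies among the last \<open>n\<close>
  states. The test \<open>1 < T\<close> excludes the empty walk, which would be accepted if
  \<open>T = 1\<close>, source and sink coincide and no colour is required.\<close>

definition program :: com where
  "program =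
     Seq setup_program (Seq main_loop
     (let z = Arr ''D'' (Add (Sub (Reg ''N'') (Reg ''n'')) (Reg ''sink'')) in
     If (And (Less (Const 1) (Reg ''T'')) (And (Less (Const 0) z) (Not (Less (Add (Reg ''f'') (Const 1)) z))))
       (Assign ''out'' (Const 1)) Skip))"

section \<open>The state graph of a numerical input\<close>

locale machine =
  fixes X :: lookup_input and n T k src snk f :: nat
  assumes src: "src < n" and snk: "snk < n"
    and colour: "\<And>v. v < n \<Longrightarrow> v \<noteq> src \<Longrightarrow> v \<noteq> snk \<Longrightarrow> in_colour X v \<in> {1..k - 2}"
    and forward: "\<And>u v t t'. u < n \<Longrightarrow> v < n \<Longrightarrow> t \<in> {1..T} \<Longrightarrow> t' \<in> {1..T} \<Longrightarrow> t \<ge> t' \<Longrightarrow>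
      in_cost X u v t t' = 0"
begin

definition M :: nat where "M = 2 ^ (k - 2)"
definition W :: nat where "W = M * n"
definition N :: nat where "N = T * W"

definition mark :: "nat \<Rightarrow> nat \<Rightarrow> nat" where
  "mark v S = (if v = src \<or> v = snk then S else set_bit (in_colour X v - 1) S)"

text \<open>Edge weights of the state graph, shifted as in \<open>encode_cost\<close>: 0 means no
  edge, \<open>Suc d\<close> an edge of cost \<open>d\<close>.\<close>

definition weight :: "nat \<Rightarrow> nat \<Rightarrow> nat" where
  "weight x y = (if mark (y mod W mod n) (x mod W div n) = y mod W div n
     then in_cost X (x mod W mod n) (y mod W mod n) (Suc (x div W)) (Suc (y div W)) else 0)"

text \<open>Records the cost of every path from the start state, least or not; minimality enters
  through \<open>optimal\<close>.\<close>

inductive reach :: "nat \<Rightarrow> nat \<Rightarrow> bool" where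
  start: "reach src 0"
| step: "reach x c \<Longrightarrow> weight x y = Suc d \<Longrightarrow> x < N \<Longrightarrow> y < N \<Longrightarrow> reach y (c + d)"

definition inputs :: "store \<Rightarrow> bool" where
  "inputs s \<longleftrightarrow> reg s ''n'' = n \<and> reg s ''T'' = T \<and> reg s ''source'' = src \<and> reg s ''sink'' = snk \<and>
     reg s ''k'' = k \<and> reg s ''f'' = f \<and> reg s ''out'' = 0"

definition ready :: "store \<Rightarrow> bool" where
  "ready s \<longleftrightarrow> inputs s \<and> reg s ''W'' = W \<and> reg s ''N'' = N"

lemma n_pos: "n > 0" using src by simp
lemma M_pos: "M > 0" by (simp add: M_def)
lemma W_pos: "W > 0" using n_pos M_pos by (simp add: W_def)

text \<open>The time is the most significant digit, so \<open>y \<le> x\<close> means that time does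
  not increase from \<open>x\<close> to \<open>y\<close>, and \<open>forward\<close> rules out an
  edge.\<close>

lemma weight_forward:
  assumes "weight x y > 0" "x < N" "y < N"
  shows "x < y"
proof (rule ccontr)
  assume "\<not> x < y"
  then have "y div W \<le> x div W" by (simp add: div_le_mono)
  moreover have "x div W < T" "y div W < T"
    using assms(2,3) by (simp_all add: N_def less_mult_imp_div_less)
  ultimately have "weight x y = 0"
    using n_pos by (auto simp: weight_def intro!: forward)
  with assms(1) show False by simp
qed

section \<open>Time and effect of the weight computation\<close>

text \<open>The doubling loop takes fewer than \<open>k - 2 < M\<close> rounds and the division is
  linear in \<open>S < M\<close>. The last conjunct is a frame condition listing the scratch
  registers.\<close>

lemma wp_add_colour:
  assumes "reg s ''source'' = src" "reg s ''sink'' = snk" "reg s ''v'' = v" "v < n" "reg s ''S'' < M"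
  shows "wp X add_colour s (\<lambda>m s'. m \<le> 200 * M \<and> arr s' = arr s \<and>
    reg s' ''S'' = mark v (reg s ''S'') \<and>
    (\<forall>z. z \<notin> {''S'', ''q'', ''P'', ''PP'', ''i'', ''d'', ''r''} \<longrightarrow> reg s' z = reg s z))"
proof (cases "v = src \<or> v = snk")
  case True
  then have "mark v S = S" for S by (simp add: mark_def)
  with True assms M_pos show ?thesis by (auto simp: add_colour_def)
next
  case False
  define q where "q = in_colour X v - 1"
  have "q < k - 2" using colour[OF assms(4)] False by (auto simp: q_def)
  also have "k - 2 < M" by (simp add: M_def)
  finally have q: "q < M" .
  have mark: "mark v S = set_bit q S" for S using False by (simp add: mark_def q_def)
  show ?thesis
    unfolding add_colour_def
    using False assms q
    apply (simp add: q_def[symmetric, simplified] mark)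
    apply (rule impI)
    apply (rule wp_doubling)
        apply simp_all
    apply (rule wp_Divmod)
       apply (simp_all add: set_bit_by_mod)
    done
qed

text \<open>Four divisions with dividends below \<open>N\<close>, each within
  \<open>20 * N\<close>.\<close>

lemma wp_decode:
  assumes "ready s" "reg s ''x'' = x" "reg s ''y'' = y" "x < N" "y < N"
  shows "wp X decode s (\<lambda>m s'. m \<le> 80 * N \<and>
    s' = s\<lparr>reg := (reg s)(''t'' := x div W, ''S'' := x mod W div n, ''u'' := x mod W mod n,
      ''t2'' := y div W, ''r'' := y mod W, ''S2'' := y mod W div n, ''v'' := y mod W mod n)\<rparr>)"
proof -
  have n: "reg s ''n'' = n" and W: "reg s ''W'' = W"
    using assms(1) by (simp_all add: ready_def inputs_def)
  have r: "Suc (x mod W) \<le> N" "Suc (y mod W) \<le> N"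
    using assms(4,5) by (meson Suc_leI le_less_trans mod_less_eq_dividend)+
  show ?thesis
    unfolding decode_def
    apply simp
    apply (rule wp_Divmod; (simp add: W W_pos assms(2,3))?)
    apply (rule wp_Divmod; (simp add: n n_pos)?)
    apply (rule wp_Divmod; (simp add: W W_pos assms(2,3))?)
    apply (rule wp_Divmod; (simp add: n n_pos)?)
    subgoal using r assms(4,5) by linarith
    done
qed

lemma wp_compute_weight:
  assumes "ready s" "reg s ''x'' = x" "reg s ''y'' = y" "x < N" "y < N"
  shows "wp X compute_weight s (\<lambda>m s'. m \<le> 400 * N \<and> arr s' = arr s \<and> ready s' \<and>
    reg s' ''w'' = weight x y \<and> reg s' ''x'' = x \<and> reg s' ''y'' = y)"
proof -
  \<comment> \<open>That some \<open>x < N\<close> exists forces \<open>T > 0\<close>, from which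
    \<open>N\<close> dominates \<open>W\<close> and \<open>M\<close>.\<close>
  have "T > 0" using assms(4) unfolding N_def by (cases T) auto
  then have "W \<le> N" by (simp add: N_def)
  moreover have "M \<le> W" using n_pos by (simp add: W_def)
  ultimately have MN: "M \<le> N" by simp
  have S: "x mod W div n < M"
    using W_pos by (simp add: W_def less_mult_imp_div_less)
  show ?thesis
    unfolding compute_weight_def wp_Seq
    apply (rule wp_mono[OF wp_decode[OF assms]])
    apply (erule conjE)
    subgoal premises p for m s'
      apply (rule wp_mono[OF wp_add_colour[where v = "y mod W mod n"]])
      using p assms(1) S n_pos apply (simp_all add: ready_def inputs_def)[5]
      subgoal premises q for m' s''
      proof -
        note q' = q[THEN conjunct2, THEN conjunct2]
        have [simp]: "reg s'' ''S'' = mark (y mod W mod n) (x mod W div n)"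
          using q' p by simp
        have "\<And>z. z \<notin> {''S'', ''q'', ''P'', ''PP'', ''i'', ''d'', ''r''} \<Longrightarrow> reg s'' z = reg s' z"
          using q' by blast
        note [simp] = this[of "''n''", simplified] this[of "''T''", simplified]
          this[of "''source''", simplified] this[of "''sink''", simplified]
          this[of "''k''", simplified] this[of "''f''", simplified] this[of "''out''", simplified]
          this[of "''W''", simplified] this[of "''N''", simplified] this[of "''x''", simplified]
          this[of "''y''", simplified] this[of "''u''", simplified] this[of "''v''", simplified]
          this[of "''t''", simplified] this[of "''t2''", simplified] this[of "''S2''", simplified]
        have "m + (m' + 30) \<le> 400 * N"
          using p q MN assms(4) by linarith
        moreover have "arr s'' = arr s" using p q by simp
        ultimately show ?thesis
          using assms p(2) by (simp add: weight_def ready_def inputs_def)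
      qed
      done
    done
qed

section \<open>Optimality of table entries under relaxation\<close>

text \<open>In shifted form: \<open>d - 1\<close> is the least cost of \<open>y\<close>, and 0
  stands for unreachable. The clauses are soundness and the lower bound.\<close>

definition optimal :: "nat \<Rightarrow> nat \<Rightarrow> bool" where
  "optimal y d \<longleftrightarrow> (\<forall>c. d = Suc c \<longrightarrow> reach y c) \<and> (\<forall>c. reach y c \<longrightarrow> 0 < d \<and> d \<le> Suc c)"

text \<open>Invariant of the inner loop: \<open>d\<close> is realised by a walk and accounts for all predecessors of
  \<open>y\<close> below \<open>x\<close>.\<close>

definition optimal_below :: "nat \<Rightarrow> nat \<Rightarrow> nat \<Rightarrow> bool" where
  "optimal_below x y d \<longleftrightarrow> (\<forall>c. d = Suc c \<longrightarrow> reach y c) \<and> (y = src \<longrightarrow> d = 1) \<and>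
     (\<forall>x' c e. x' < x \<longrightarrow> reach x' c \<longrightarrow> weight x' y = Suc e \<longrightarrow> 0 < d \<and> d \<le> Suc (c + e))"

lemma optimal_below_0: "optimal_below 0 y (if y = src then 1 else 0)"
  by (auto simp: optimal_below_def intro: start)

text \<open>By \<open>weight_forward\<close>, the last edge of any path to \<open>y\<close> starts
  below \<open>y\<close>, so all predecessors are accounted for; the path of length 0 is covered by
  the clause for \<open>src\<close>.\<close>

lemma optimal_below_self:
  assumes "optimal_below y y d" "y < N"
  shows "optimal y d"
proof -
  have "0 < d \<and> d \<le> Suc c" if "reach y c" for c
    using that
  proof (cases rule: reach.cases)
    case start
    with assms show ?thesis by (simp add: optimal_below_def)
  next
    case (step x c' e)
    then have "x < y" using weight_forward[of x y] by simp
    with step assms show ?thesis by (auto simp: optimal_below_def)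
  qed
  with assms show ?thesis by (auto simp: optimal_below_def optimal_def)
qed

text \<open>The minimum of \<open>d\<close> and \<open>a + w - 1\<close>, with 0 in the role of
  infinity.\<close>

definition relaxed :: "nat \<Rightarrow> nat \<Rightarrow> nat \<Rightarrow> nat" where
  "relaxed a w d = (if 0 < a \<and> 0 < w \<and> \<not> (0 < d \<and> d < a + w) then a + w - 1 else d)"

text \<open>The new candidates are the paths with last edge from \<open>x\<close>. As
  \<open>a\<close> is optimal for \<open>x\<close>, the best of them has the shifted cost
  \<open>a + weight x y - 1\<close>.\<close>

lemma optimal_below_Suc:
  assumes "optimal_below x y d" "optimal x a" "x < N" "y < N"
  shows "optimal_below (Suc x) y (relaxed a (weight x y) d)"
proof -
  let ?d = "relaxed a (weight x y) d"
  have "reach y c" if "?d = Suc c" for c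
  proof (cases "?d = d")
    case True
    with that assms(1) show ?thesis by (simp add: optimal_below_def)
  next
    case False
    then obtain a' w where aw: "a = Suc a'" "weight x y = Suc w"
      by (cases a; cases "weight x y") (auto simp: relaxed_def)
    then have "reach x a'" using assms(2) by (simp add: optimal_def)
    from step[OF this aw(2) assms(3,4)] that False show ?thesis
      by (auto simp: relaxed_def aw split: if_splits)
  qed
  moreover have "?d = 1" if "y = src"
    \<comment> \<open>The entry 1 is never overwritten: \<open>1 < a + w\<close> whenever both are
      positive.\<close>
    using that assms(1) by (auto simp: optimal_below_def relaxed_def)
  moreover have "0 < ?d \<and> ?d \<le> Suc (c + e)"
    if "x' < Suc x" "reach x' c" "weight x' y = Suc e" for x' c e
  proof (cases "x' = x")
    case True
    then have "0 < a \<and> a \<le> Suc c" using that assms(2) by (simp add: optimal_def)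
    with True that show ?thesis by (auto simp: relaxed_def)
  next
    case False
    then have "0 < d \<and> d \<le> Suc (c + e)"
      using that assms(1) by (auto simp: optimal_below_def less_Suc_eq)
    then show ?thesis by (auto simp: relaxed_def)
  qed
  ultimately show ?thesis by (auto simp: optimal_below_def)
qed

section \<open>Time and effect of the loops and the whole program\<close>

lemma wp_relax:
  assumes "reg s ''x'' = x" "reg s ''y'' = y" "reg s ''w'' = w"
  shows "wp X relax s (\<lambda>m s'. m \<le> 50 \<and> reg s' = reg s \<and>
    arr s' ''D'' = (arr s ''D'')(y := relaxed (arr s ''D'' x) w (arr s ''D'' y)))"
  using assms by (auto simp: relax_def relaxed_def Let_def)

lemma wp_pair:
  assumes "ready s" "reg s ''x'' = x" "reg s ''y'' = y" "x < N" "y < N"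
  shows "wp X (Seq compute_weight relax) s (\<lambda>m s'. m \<le> 450 * N \<and> ready s' \<and>
    reg s' ''x'' = x \<and> reg s' ''y'' = y \<and>
    arr s' ''D'' = (arr s ''D'')(y := relaxed (arr s ''D'' x) (weight x y) (arr s ''D'' y)))"
  apply simp
  apply (rule wp_mono[OF wp_compute_weight[OF assms]])
  apply (rule wp_mono[OF wp_relax[OF refl refl refl]])
  using assms(4) by (auto simp: ready_def inputs_def)

text \<open>During the loop, entries below \<open>y\<close> are final, those above \<open>y\<close>
  still initial, and the entry of \<open>y\<close> satisfies \<open>optimal_below j\<close>.\<close>

lemma wp_inner:
  assumes "ready s" "reg s ''y'' = y" "y < N"
    and "\<forall>y' < y. optimal y' (arr s ''D'' y')"
    and "\<forall>y' \<ge> y. arr s ''D'' y' = (if y' = src then 1 else 0)"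
  shows "wp X (For ''x'' ''y'' (Seq compute_weight relax)) s (\<lambda>m s'. m \<le> 500 * N * N \<and>
    ready s' \<and> reg s' ''y'' = y \<and> (\<forall>y' < Suc y. optimal y' (arr s' ''D'' y')) \<and>
    (\<forall>y' \<ge> Suc y. arr s' ''D'' y' = (if y' = src then 1 else 0)))"
proof (rule wp_For[where L = y and b = "450 * N" and
    Inv = "\<lambda>j s'. ready s' \<and> reg s' ''x'' = j \<and> reg s' ''y'' = y \<and>
      (\<forall>y' < y. optimal y' (arr s' ''D'' y')) \<and>
      (\<forall>y' > y. arr s' ''D'' y' = (if y' = src then 1 else 0)) \<and>
      optimal_below j y (arr s' ''D'' y)"], goal_cases)
  case 1
  show ?case
    using assms optimal_below_0[of y] by (simp add: ready_def inputs_def)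
next
  case (2 j s)
  then show ?case by simp
next
  case (3 j s')
  show ?case
    apply (rule wp_mono[OF wp_pair[where x = j and y = y]])
    using 3 assms(3) optimal_below_Suc[of j y "arr s' ''D'' y" "arr s' ''D'' j"]
    by (auto simp: ready_def inputs_def)
next
  case (4 m s')
  have "y * (450 * N + 8) + 6 \<le> 500 * N * N"
  proof -
    \<comment> \<open>Using \<open>y \<le> N - 1\<close> saves \<open>458 * N\<close>, which absorbs
      the additive constant 6.\<close>
    have "y * (450 * N + 8) \<le> (N - 1) * (458 * N)"
      using assms(3) by (intro mult_le_mono) auto
    moreover have "(N - 1) * (458 * N) + 458 * N = 458 * (N * N)"
      using assms(3) by (cases N) (auto simp: algebra_simps)
    ultimately show ?thesis using assms(3) unfolding mult.assoc by linarith
  qed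
  with 4 optimal_below_self[OF _ assms(3)] show ?case
    by (auto simp: less_Suc_eq)
qed

lemma wp_main_loop:
  assumes "ready s" "arr s ''D'' = (\<lambda>_. 0)(src := 1)"
  shows "wp X main_loop s (\<lambda>m s'. m \<le> 6 + N * (500 * N * N + 8) \<and> ready s' \<and>
    (\<forall>y < N. optimal y (arr s' ''D'' y)))"
  unfolding main_loop_def
proof (rule wp_For[where L = N and b = "500 * N * N" and
    Inv = "\<lambda>j s'. ready s' \<and> reg s' ''y'' = j \<and>
      (\<forall>y < j. optimal y (arr s' ''D'' y)) \<and>
      (\<forall>y \<ge> j. arr s' ''D'' y = (if y = src then 1 else 0))"], goal_cases)
  case 1
  show ?case using assms by (simp add: ready_def inputs_def)
next
  case (2 j s)
  then show ?case by (simp add: ready_def)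
next
  case (3 j s')
  show ?case
    apply (rule wp_mono[OF wp_inner[where y = j]])
    using 3 by (auto simp: ready_def inputs_def)
next
  case (4 m s')
  then show ?case by simp
qed

lemma wp_setup:
  assumes "inputs s" "reg s ''W'' = 0" "reg s ''N'' = 0" "arr s = (\<lambda>_ _. 0)"
  shows "wp X setup_program s (\<lambda>m s'. m \<le> 100 * (M + T) \<and> ready s' \<and>
    arr s' ''D'' = (\<lambda>_. 0)(src := 1))"
proof -
  have k: "k - 2 < M" by (simp add: M_def)
  show ?thesis
    unfolding setup_program_def
    using assms k
    apply (simp add: inputs_def)
    apply (rule wp_doubling; simp?)
    apply (rule wp_summing; simp?)
    apply (rule wp_summing; simp?)
    subgoal for m1 m2 m3
      apply (simp add: ready_def inputs_def N_def W_def M_def)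
      using less_exp[of "k - 2"] by linarith
    done
qed

text \<open>A separate bound \<open>B\<close> is taken because \<open>N\<close> does not dominate
  \<open>M\<close> if \<open>T = 0\<close>. The cube comes from \<open>N\<close> outer rounds of
  time quadratic in \<open>N\<close>.\<close>

lemma wp_program:
  assumes "inputs s" "reg s ''W'' = 0" "reg s ''N'' = 0" "arr s = (\<lambda>_ _. 0)"
    and B: "M \<le> B" "T \<le> B" "N \<le> B" "1 \<le> B"
  shows "wp X program s (\<lambda>m s'. m \<le> 1000 * B ^ 3 \<and>
    reg s' ''out'' = (if 2 \<le> T \<and> (\<exists>c\<le>f. reach (N - n + snk) c) then 1 else 0))"
proof -
  have *: "arr s' ''D'' (N - n + snk) > 0 \<and> arr s' ''D'' (N - n + snk) \<le> Suc f \<longleftrightarrow>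
      (\<exists>c\<le>f. reach (N - n + snk) c)"
    if "2 \<le> T" "\<forall>y < N. optimal y (arr s' ''D'' y)" for s' :: store
  proof -
    let ?z = "N - n + snk"
    \<comment> \<open>Hence the subtraction in \<open>N - n\<close> is not truncated.\<close>
    have "n \<le> N" using that(1) M_pos by (simp add: N_def W_def)
    then have "?z < N" using snk by simp
    with that have opt: "optimal ?z (arr s' ''D'' ?z)" by simp
    then show ?thesis
      by (cases "arr s' ''D'' ?z") (auto simp: optimal_def)
  qed
  have B3: "B \<le> B ^ 3" "1 \<le> B ^ 3" using B(4) by (simp_all add: power3_eq_cube)
  have "N * (500 * N * N + 8) \<le> B * (508 * B * B)"
  proof -
    have "500 * N * N + 8 \<le> 500 * B * B + 8 * B * B"
      using mult_le_mono[OF B(3) B(3)] mult_le_mono[OF B(4) B(4)] unfolding mult.assoc by linarith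
    then show ?thesis using B by (intro mult_le_mono) auto
  qed
  also have "B * (508 * B * B) = 508 * B ^ 3" by (simp add: power3_eq_cube)
  finally have "N * (500 * N * N + 8) \<le> 508 * B ^ 3" .
  moreover have "100 * (M + T) \<le> 200 * B" using B by simp
  ultimately have bound: "100 * (M + T) + (6 + N * (500 * N * N + 8)) + 50 \<le> 1000 * B ^ 3"
    using B3 by linarith
  show ?thesis
    unfolding program_def wp_Seq
    apply (rule wp_mono[OF wp_setup[OF assms(1-4)]])
    apply clarify
    apply (rule wp_mono[OF wp_main_loop])
      apply assumption+
    subgoal for m1 s1 m2 s2
      using bound *[of s2] by (auto simp: Let_def ready_def inputs_def not_less)
    done
qed

end

section \<open>Temporal walks and paths of states\<close>

locale numbered_instance =
  fixes I :: "'v ccto_instance" and e :: "nat \<Rightarrow> 'v"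
  assumes wf: "ccto_wf I" and num: "numbering e (verts (graph I))"
begin

abbreviation "G \<equiv> graph I"
abbreviation "n \<equiv> card (verts G)"
abbreviation "index \<equiv> inv_into {..<n} e"

lemma e_in: "i < n \<Longrightarrow> e i \<in> verts G"
  using num by (auto simp: numbering_def bij_betw_def)

lemma index_less: "v \<in> verts G \<Longrightarrow> index v < n"
  using num inv_into_into[of v e "{..<n}"] by (auto simp: numbering_def bij_betw_def)

lemma e_index: "v \<in> verts G \<Longrightarrow> e (index v) = v"
  using num by (auto simp: numbering_def bij_betw_def f_inv_into_f)

lemma index_e: "i < n \<Longrightarrow> index (e i) = i"
  using num by (auto simp: numbering_def bij_betw_def)

lemma source_in: "source I \<in> verts G" and sink_in: "sink I \<in> verts G"
  and tcg: "temporal_cost_graph G"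
  using wf by (simp_all add: ccto_wf_def)

lemma e_eq_iff: "v < n \<Longrightarrow> u \<in> verts G \<Longrightarrow> e v = u \<longleftrightarrow> v = index u"
  by (metis e_index index_e)

lemma lookup_simps [simp]:
  "in_cost (ccto_lookup I e) i j t t' = encode_cost (cost G (e i) (e j) t t')"
  "in_colour (ccto_lookup I e) i = colouring I (e i)"
  by (simp_all add: ccto_lookup_def)

text \<open>Infinite costs are encoded by 0, which turns the first axiom of temporal cost graphs
  into \<open>forward\<close>.\<close>

sublocale machine "ccto_lookup I e" n "horizon G" "num_k I" "index (source I)" "index (sink I)" "budget I"
proof
  show "index (source I) < n" "index (sink I) < n"
    using source_in sink_in index_less by auto
next
  fix v assume v: "v < n" "v \<noteq> index (source I)" "v \<noteq> index (sink I)"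
  then have "e v \<in> verts G - {source I, sink I}"
    using e_in e_eq_iff source_in sink_in by auto
  then show "in_colour (ccto_lookup I e) v \<in> {1..num_k I - 2}"
    using wf by (auto simp: ccto_wf_def colours_def)
next
  fix u v t t' assume "u < n" "v < n" "t \<in> {1..horizon G}" "t' \<in> {1..horizon G}" "t' \<le> t"
  then have "cost G (e u) (e v) t t' = \<infinity>"
    using tcg e_in by (auto simp: temporal_cost_graph_def times_def)
  then show "in_cost (ccto_lookup I e) u v t t' = 0"
    by (simp add: encode_cost_def)
qed

abbreviation "T \<equiv> horizon G"

definition state :: "nat \<Rightarrow> nat \<Rightarrow> nat \<Rightarrow> nat" where
  "state t S u = t * W + (S * n + u)"

lemma state_offset_less:
  assumes "S < M" "u < n"
  shows "S * n + u < W"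
proof -
  have "S * n + u < Suc S * n" using assms by simp
  also have "\<dots> \<le> W" unfolding W_def using assms by (intro mult_le_mono1) simp
  finally show ?thesis .
qed

lemma decode_state:
  assumes "S < M" "u < n"
  shows "state t S u div W = t" "state t S u mod W div n = S" "state t S u mod W mod n = u"
  using state_offset_less[OF assms] assms by (simp_all add: state_def)

lemma state_less:
  assumes "S < M" "u < n" "t < T"
  shows "state t S u < N"
proof -
  have "state t S u < Suc t * W" using state_offset_less[OF assms(1,2)] by (simp add: state_def)
  also have "\<dots> \<le> N" unfolding N_def using assms(3) by (intro mult_le_mono1) simp
  finally show ?thesis .
qed

lemma bit_mark_iff:
  assumes "v < n"
  shows "bit (mark v S) q \<longleftrightarrow>
    bit S q \<or> (e v \<noteq> source I \<and> e v \<noteq> sink I \<and> colouring I (e v) - 1 = q)"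
  using assms e_eq_iff source_in sink_in
  by (auto simp: mark_def bit_set_bit_iff)

text \<open>Only bits below \<open>k - 2\<close> are ever set; being below
  \<open>2 ^ (k - 2)\<close> is expressed as being fixed by \<open>take_bit\<close>.\<close>

lemma mark_less:
  assumes "v < n" "S < M"
  shows "mark v S < M"
proof (cases "v = index (source I) \<or> v = index (sink I)")
  case False
  then have "in_colour (ccto_lookup I e) v - 1 < num_k I - 2"
    using colour[OF assms(1)] by auto
  with assms(2) show ?thesis
    unfolding M_def mark_def
    by (auto simp: take_bit_set_bit_eq simp flip: take_bit_nat_eq_self_iff)
qed (use assms in \<open>auto simp: mark_def\<close>)

definition wanted :: "'v set \<Rightarrow> nat set" where
  "wanted A = (\<lambda>v. colouring I v - 1) ` (A - {source I, sink I})"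

text \<open>Admits the empty walk, located at the source at time 1, as the base case for induction
  on the last step.\<close>

definition walk_to :: "'v \<Rightarrow> nat \<Rightarrow> 'v step list \<Rightarrow> bool" where
  "walk_to v t w \<longleftrightarrow> valid_walk G w \<and>
    (if w = [] then v = source I \<and> t = 1
     else walk_from_to (source I) v w \<and> snd (snd (snd (last w))) = t)"

text \<open>An empty \<open>w\<close> fits in with \<open>t0 = 1\<close>, as every time is at least
  1. The slack in \<open>t0 \<le> t\<close> is waiting before departure.\<close>

lemma walk_to_snoc:
  "walk_to v t' (w @ [(u, v', t, t'')]) \<longleftrightarrow> v' = v \<and> t'' = t' \<and>
    u \<in> verts G \<and> v \<in> verts G \<and> t \<in> times G \<and> t' \<in> times G \<and> t < t' \<and> cost G u v t t' < \<infinity> \<and>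
    (\<exists>t0 \<le> t. walk_to u t0 w)"
proof (cases "w = []")
  case True
  then show ?thesis
    by (auto simp: walk_to_def valid_walk_def walk_from_to_def times_def)
next
  case False
  obtain a b c d where l: "last w = (a, b, c, d)" by (cases "last w") auto
  show ?thesis using False l
    by (auto simp: walk_to_def valid_walk_def walk_from_to_def successively_append_iff)
qed

lemma walk_cost_snoc: "walk_cost G (w @ [(u, v, t, t')]) = walk_cost G w + cost G u v t t'"
  by (simp add: walk_cost_def)

lemma visited_snoc: "visited (w @ [(u, v, t, t')]) = visited w \<union> {u, v}"
  by (auto simp: visited_def)

text \<open>The exception for the source stems from the empty walk. It is harmless, as the source
  has no colour: leaving \<open>v\<close> contributes nothing new to \<open>wanted\<close>.\<close>

lemma end_visited: "walk_to v t w \<Longrightarrow> v \<in> insert (source I) (visited w)"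
  by (cases w rule: rev_cases) (auto simp: walk_to_def walk_from_to_def visited_def split: if_splits)

text \<open>Every edge of the state graph is a walk step, and a bit is set only on arrival at a
  vertex of its colour.\<close>

lemma reach_imp_walk:
  assumes "reach y c" "0 < T"
  shows "\<exists>w. walk_to (e (y mod W mod n)) (Suc (y div W)) w \<and> walk_cost G w = enat c \<and>
    {q. bit (y mod W div n) q} \<subseteq> wanted (visited w)"
  using assms(1)
proof (induction rule: reach.induct)
  case start
  have "index (source I) = state 0 0 (index (source I))" by (simp add: state_def)
  with decode_state[of 0 "index (source I)" 0] M_pos src
  show ?case
    by (intro exI[of _ "[]"]) (auto simp: walk_to_def valid_walk_def walk_cost_def e_index source_in zero_enat_def)
next
  case (step x c y d)
  define u v t t' where "u = x mod W mod n" "v = y mod W mod n" "t = x div W" "t' = y div W"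
  note defs = this
  have uv: "u < n" "v < n" using n_pos by (auto simp: defs)
  have tt: "t < T" "t' < T" using step.hyps by (simp_all add: defs N_def less_mult_imp_div_less)
  have mark: "mark v (x mod W div n) = y mod W div n"
    and "encode_cost (cost G (e u) (e v) (Suc t) (Suc t')) = Suc d"
    using step.hyps(2) by (auto simp: weight_def defs split: if_splits)
  then have cost: "cost G (e u) (e v) (Suc t) (Suc t') = enat d"
    by (auto simp: encode_cost_def split: enat.splits)
  have "Suc t < Suc t'"
  proof (rule ccontr)
    assume "\<not> Suc t < Suc t'"
    then have "cost G (e u) (e v) (Suc t) (Suc t') = \<infinity>"
      using tcg e_in uv tt by (simp add: temporal_cost_graph_def times_def)
    with cost show False by simp
  qed
  moreover obtain w where w: "walk_to (e u) (Suc t) w" "walk_cost G w = enat c"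
    "{q. bit (x mod W div n) q} \<subseteq> wanted (visited w)"
    using step.IH by (auto simp: defs)
  ultimately have "walk_to (e v) (Suc t') (w @ [(e u, e v, Suc t, Suc t')])"
    using uv tt cost by (auto simp: walk_to_snoc e_in times_def)
  moreover have "{q. bit (y mod W div n) q} \<subseteq> wanted (visited (w @ [(e u, e v, Suc t, Suc t')]))"
    using w(3) uv by (auto simp: mark[symmetric] bit_mark_iff visited_snoc wanted_def)
  ultimately show ?case
    using w(2) cost by (auto simp: walk_cost_snoc defs)
qed

lemma reach_state_step:
  assumes "reach (state t S u) c" "S < M" "u < n" "v < n" "t < T" "t' < T"
    and "cost G (e u) (e v) (Suc t) (Suc t') = enat d"
  shows "reach (state t' (mark v S) v) (c + d)"
  using assms
  by (intro step[OF assms(1)])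
    (simp_all add: weight_def decode_state mark_less state_less encode_cost_def)

text \<open>Waiting is a step from \<open>u\<close> to itself at cost 0. It marks the colour of
  \<open>u\<close>, so only a superset of \<open>S\<close> is claimed.\<close>

lemma reach_wait:
  assumes "reach (state t S u) c" "S < M" "u < n" "t \<le> t'" "t' < T"
  shows "\<exists>S' < M. {q. bit S q} \<subseteq> {q. bit S' q} \<and> reach (state t' S' u) c"
proof (cases "t = t'")
  case False
  then have "cost G (e u) (e u) (Suc t) (Suc t') = enat 0"
    using assms tcg e_in[OF assms(3)]
    by (simp add: temporal_cost_graph_def times_def flip: zero_enat_def)
  from reach_state_step[OF assms(1-3,3) _ _ this] show ?thesis
    using assms False by (intro exI[of _ "mark u S"]) (auto simp: mark_less bit_mark_iff)
qed (use assms in auto)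

text \<open>Induction on the last step, with gaps between steps filled by waiting. A superset of the
  wanted bits suffices, because the target has all of them.\<close>

lemma walk_imp_reach:
  assumes "walk_to v t w"
  shows "\<exists>S < M. \<exists>c. wanted (visited w) \<subseteq> {q. bit S q} \<and>
    reach (state (t - 1) S (index v)) c \<and> walk_cost G w = enat c"
  using assms
proof (induction w arbitrary: v t rule: rev_induct)
  case Nil
  then show ?case
    using M_pos start
    by (auto simp: walk_to_def visited_def wanted_def walk_cost_def state_def zero_enat_def)
next
  case (snoc s w)
  obtain u t1 t0 where s: "s = (u, v, t1, t)" and uv: "u \<in> verts G" "v \<in> verts G"
    and t: "t1 \<in> times G" "t \<in> times G" "t1 < t" and fin: "cost G u v t1 t < \<infinity>"
    and t0: "t0 \<le> t1" "walk_to u t0 w"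
    using snoc.prems by (cases s) (auto simp: walk_to_snoc)
  obtain S c where S: "S < M" "wanted (visited w) \<subseteq> {q. bit S q}"
    "reach (state (t0 - 1) S (index u)) c" "walk_cost G w = enat c"
    using snoc.IH[OF t0(2)] by blast
  \<comment> \<open>A wait from the arrival \<open>t0\<close> to the departure \<open>t1\<close>;
    digits are times minus 1.\<close>
  obtain S' where S': "S' < M" "{q. bit S q} \<subseteq> {q. bit S' q}" "reach (state (t1 - 1) S' (index u)) c"
    using reach_wait[OF S(3,1) index_less[OF uv(1)], of "t1 - 1"] t t0(1)
    unfolding times_def by fastforce
  obtain d where d: "cost G u v t1 t = enat d" using fin by auto
  have "reach (state (t - 1) (mark (index v) S') (index v)) (c + d)"
    using S'(1) uv t d index_less
    by (intro reach_state_step[OF S'(3)]) (auto simp: times_def e_index)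
  moreover have "wanted (visited (w @ [s])) \<subseteq> {q. bit (mark (index v) S') q}"
    using S(2) S'(2) end_visited[OF t0(2)] index_less uv
    by (auto simp: s visited_snoc wanted_def bit_mark_iff e_index)
  ultimately show ?case
    using mark_less[OF index_less[OF uv(2)] S'(1)] S(4) d
    by (auto simp: s walk_cost_snoc)
qed

text \<open>\<open>M - 1\<close> has all \<open>k - 2\<close> bits set, that is, it is the full
  colour set.\<close>

lemma final_state:
  assumes "0 < T"
  shows "N - n + index (sink I) = state (T - 1) (M - 1) (index (sink I))"
proof -
  obtain t m where "T = Suc t" "M = Suc m" using assms M_pos by (metis gr0_implies_Suc)
  then show ?thesis unfolding N_def W_def state_def by simp
qed

text \<open>A solution is prolonged by waiting at the sink until \<open>T\<close>, where its colour
  set must be full. Conversely, a path to the final state yields a walk, nonempty since it ends at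
  time \<open>T \<ge> 2\<close>.\<close>

lemma ccto_yes_iff:
  "ccto_yes I \<longleftrightarrow> 2 \<le> T \<and> (\<exists>c \<le> budget I. reach (N - n + index (sink I)) c)"
proof
  assume "ccto_yes I"
  then obtain w where w: "valid_walk G w" "walk_from_to (source I) (sink I) w"
    "\<forall>q \<in> colours I. \<exists>v \<in> visited w - {source I, sink I}. colouring I v = q"
    "walk_cost G w \<le> enat (budget I)"
    by (auto simp: ccto_yes_def)
  define t where "t = snd (snd (snd (last w)))"
  have "last w \<in> set w" using w(2) by (simp add: walk_from_to_def)
  \<comment> \<open>The last step arrives strictly after a departure at time 1 or later.\<close>
  with w(1) have t: "t \<le> T" "2 \<le> T"
    by (auto simp: valid_walk_def t_def times_def)
  have "walk_to (sink I) t w"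
    using w(1,2) by (auto simp: walk_to_def t_def walk_from_to_def)
  then obtain S c where S: "S < M" "wanted (visited w) \<subseteq> {q. bit S q}"
    "reach (state (t - 1) S (index (sink I))) c" "walk_cost G w = enat c"
    using walk_imp_reach by blast
  obtain S' where S': "S' < M" "{q. bit S q} \<subseteq> {q. bit S' q}"
      "reach (state (T - 1) S' (index (sink I))) c"
    using reach_wait[OF S(3,1) snk, of "T - 1"] t by fastforce
  have "bit S' q" if "q < num_k I - 2" for q
  proof -
    have "Suc q \<in> colours I" using that by (simp add: colours_def)
    then obtain v where "v \<in> visited w - {source I, sink I}" "colouring I v = Suc q"
      using w(3) by blast
    then have "q \<in> wanted (visited w)" by (force simp: wanted_def)
    with S(2) S'(2) show ?thesis by auto
  qed
  moreover have "q < num_k I - 2" if "bit S' q" for q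
  proof -
    have "take_bit (num_k I - 2) S' = S'"
      using S'(1) by (simp add: M_def take_bit_nat_eq_self_iff)
    with that show ?thesis by (metis bit_take_bit_iff)
  qed
  \<comment> \<open>All bits below \<open>k - 2\<close> are set because every colour is visited, and
    no others because \<open>S' < M\<close>.\<close>
  ultimately have "S' = mask (num_k I - 2)"
    by (intro bit_eqI) (auto simp: bit_mask_iff)
  then have "S' = M - 1" by (simp add: mask_eq_exp_minus_1 M_def)
  with S' S(4) w(4) t show "2 \<le> T \<and> (\<exists>c \<le> budget I. reach (N - n + index (sink I)) c)"
    by (auto simp: final_state)
next
  assume R: "2 \<le> T \<and> (\<exists>c \<le> budget I. reach (N - n + index (sink I)) c)"
  then obtain c where c: "c \<le> budget I" "reach (state (T - 1) (M - 1) (index (sink I))) c"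
    by (auto simp: final_state)
  have "M - 1 < M" using M_pos by simp
  from reach_imp_walk[OF c(2)] decode_state[OF this snk]
  obtain w where w: "walk_to (sink I) T w" "walk_cost G w = enat c"
      "{q. bit (M - 1) q} \<subseteq> wanted (visited w)"
    using R by (auto simp: e_index sink_in)
  have walk: "valid_walk G w" "walk_from_to (source I) (sink I) w"
    using w(1) R by (auto simp: walk_to_def split: if_splits)
  have V: "visited w \<subseteq> verts G"
    using walk(1) by (auto simp: visited_def valid_walk_def)
  have "\<exists>v \<in> visited w - {source I, sink I}. colouring I v = q" if "q \<in> colours I" for q
  proof -
    have "bit (M - 1) (q - 1)"
      using that unfolding M_def mask_eq_exp_minus_1[symmetric]
      by (auto simp: colours_def bit_mask_iff)
    then have "q - 1 \<in> wanted (visited w)" using w(3) by blast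
    then obtain v where v: "v \<in> visited w - {source I, sink I}" "colouring I v - 1 = q - 1"
      unfolding wanted_def by fastforce
    \<comment> \<open>Both colours are thus at least 1, so equality after subtracting 1 gives
      equality.\<close>
    moreover have "colouring I v \<in> colours I" using v(1) V wf by (auto simp: ccto_wf_def)
    ultimately show ?thesis using that by (intro bexI[of _ v]) (auto simp: colours_def)
  qed
  with walk w(2) c(1) show "ccto_yes I" by (auto simp: ccto_yes_def)
qed

end

section \<open>The factorial bound and the final estimate\<close>

text \<open>From 8 on, each new factor of the factorial is at least 8; smaller \<open>k\<close> are
  covered by the constant.\<close>

lemma pow8_le_fact: "8 ^ k \<le> 8 ^ 8 * (fact k :: nat)"
proof (cases "k \<le> 8")
  case True
  then have "(8 :: nat) ^ k \<le> 8 ^ 8" by (intro power_increasing) auto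
  also have "\<dots> \<le> 8 ^ 8 * fact k" by simp
  finally show ?thesis .
next
  case False
  then have "8 \<le> k" by simp
  then show ?thesis
  proof (induction k rule: dec_induct)
    case (step k)
    have "8 * 8 ^ k \<le> Suc k * (8 ^ 8 * fact k)"
      using step by (intro mult_le_mono) auto
    then show ?case by (simp add: algebra_simps)
  qed simp
qed

theorem theorem6:
  shows "\<exists>(prog :: com) (C :: nat). \<forall>(I :: 'v ccto_instance) (e :: nat \<Rightarrow> 'v).
    ccto_wf I \<and> numbering e (verts (graph I)) \<longrightarrow>
    decides_ccto_in prog I e
      (C * (fact (num_k I) * card (verts (graph I)) ^ 4 * lifetime (graph I) ^ 4))"
proof (intro exI allI impI)
  fix I :: "'v ccto_instance" and e :: "nat \<Rightarrow> 'v"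
  assume "ccto_wf I \<and> numbering e (verts (graph I))"
  then interpret numbered_instance I e by unfold_locales auto
  define L where "L = lifetime G"
  have L: "T \<le> L" "1 \<le> L"
  proof -
    have "lifetime G = T" if "1 \<le> T"
      using lifetime_eq_horizon[OF tcg _ that] source_in by blast
    \<comment> \<open>With horizon 0, the default value in \<open>lifetime\<close> applies.\<close>
    moreover have "lifetime G = 1" if "T = 0"
      using that by (simp add: lifetime_def times_def)
    ultimately show "T \<le> L" "1 \<le> L" unfolding L_def by (cases "T = 0"; simp)+
  qed
  \<comment> \<open>With \<open>L\<close> instead of \<open>T\<close>, \<open>B\<close> is positive
    and dominates \<open>M\<close> even for horizon 0.\<close>
  define B where "B = L * (M * n)"
  have B: "M \<le> B" "T \<le> B" "N \<le> B" "1 \<le> B"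
    using L M_pos n_pos mult_le_mono[of 1 L M "M * n"] mult_le_mono[of T L 1 "M * n"]
    by (auto simp: B_def N_def W_def)
  \<comment> \<open>The base 8 arises as the cube of the 2 in \<open>M\<close>.\<close>
  have "B ^ 3 = 8 ^ (num_k I - 2) * (n ^ 3 * L ^ 3)"
    by (simp add: B_def M_def power_mult_distrib flip: power_mult) (simp add: mult.commute power_mult)
  also have "\<dots> \<le> (8 ^ 8 * fact (num_k I)) * (n ^ 4 * L ^ 4)"
  proof (intro mult_le_mono)
    have "(8 :: nat) ^ (num_k I - 2) \<le> 8 ^ num_k I" by (intro power_increasing) auto
    also note pow8_le_fact
    finally show "(8 :: nat) ^ (num_k I - 2) \<le> 8 ^ 8 * fact (num_k I)" .
    show "n ^ 3 \<le> n ^ 4" "L ^ 3 \<le> L ^ 4"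
      using n_pos L by (auto intro: power_increasing)
  qed
  finally have bound: "1000 * B ^ 3 \<le> 1000 * 8 ^ 8 * (fact (num_k I) * n ^ 4 * L ^ 4)"
    by (simp add: algebra_simps)
  have "wp (ccto_lookup I e) program (ccto_init I e) (\<lambda>m s. m \<le> 1000 * B ^ 3 \<and>
    reg s ''out'' = (if 2 \<le> T \<and> (\<exists>c \<le> budget I. reach (N - n + index (sink I)) c) then 1 else 0))"
    using B by (intro wp_program) (simp_all add: inputs_def ccto_init_def Let_def)
  with bound show "decides_ccto_in program I e
      (1000 * 8 ^ 8 * (fact (num_k I) * n ^ 4 * lifetime G ^ 4))"
    unfolding decides_ccto_in_def wp_def ccto_yes_iff L_def by (meson le_trans)
qed

end
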